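(* In the genus one setting of the context, define $\tilde s_0=u_1/2$, $\tilde s_1=-\tilde s_0(v_0+v_1)$ and, for $j\ge2$, $$\tilde s_j=\tilde\alpha\tilde s_{j-1}+\tilde\beta\tilde s_{j-2}+\tilde\gamma\sum_{i=0}^{j-2}\tilde s_i\tilde s_{j-2-i},\qquad \tilde\alpha=-2v_0,\ \tilde\beta=d_0-d_1,\ \tilde\gamma=d_1/\tilde s_0,$$ and let $D_n=\det(\tilde s_{i+j-2})_{i,j=1}^n$ ($D_0=1$). Then $d_n=\dfrac{D_nD_{n-2}}{D_{n-1}^2}$ for $n\ge2$. Moreover $D_n=\Delta_n$ for all $n\ge0$, where $\Delta_n=\det(s_{i+j-2})_{i,j=1}^n$ with $s_0=u_1/2$, $s_1=-s_0v_1$ and $s_j=-(2d_1+f)s_{j-2}+s_0^{-1}d_1\big(\sum_{i=0}^{j-2}s_is_{j-2-i}-v_0\sum_{i=0}^{j-3}s_is_{j-3-i}\big)$ for $j\ge2$; hence $D_{n+4}D_n=u^2D_{n+3}D_{n+1}+u^2(v^2+f)D_{n+2}^2$ for all $n\ge0$.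
   Context: Genus one setting: curve $Y^2=(X^2+f)^2+4u(X-v)$ with $f,u,v\in\mathbb{C}$; point at infinity $\infty_1$ where $Y\sim X^2$, expansions in powers of $X^{-1}$. Take $P_0=X^2+f+2d_0$ and $Q_0=u_0(X-v_0)$, $u_0\neq0$, with $Q_0\mid F-P_0^2$ where $F=(X^2+f)^2+4u(X-v)$, and $Y_0=(Y+P_0)/Q_0$. The continued fraction $Y_n=a_n+1/Y_{n+1}$, $a_n=\lfloor Y_n\rfloor$, gives $a_n=2(X+v_n)/u_n$, $Y_n=(Y+P_n)/Q_n$, $P_n=X^2+f+2d_n$, $Q_n=u_n(X-v_n)$, with $F=P_n^2+Q_nQ_{n-1}$ and $4d_n+u_nu_{n-1}=0$; all $u_n,d_n$ are assumed nonzero. *)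

theory Defs
  imports
    "HOL-Computational_Algebra.Formal_Laurent_Series"
    "Jordan_Normal_Form.Determinant"
begin

text \<open>
  Expansions at the point at infinity are formal Laurent series in the local parameter
  \<open>1/X\<close>: \<^const>\<open>fls_X\<close> is \<open>1/X\<close>, \<^const>\<open>fls_X_inv\<close> is \<open>X\<close>, and \<open>fls_nth y (- k)\<close> is the
  coefficient of \<open>X^k\<close> in \<open>y\<close>.
\<close>

definition at_infty :: "complex poly \<Rightarrow> complex fls" where
  "at_infty p = poly (map_poly fls_const p) fls_X_inv"

text \<open>The polynomial part \<open>\<lfloor>y\<rfloor>\<close>; \<^const>\<open>fls_prpart\<close> omits the constant term.\<close>

definition poly_part :: "complex fls \<Rightarrow> complex poly" where
  "poly_part y = fls_prpart y + [:fls_nth y 0:]"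

text \<open>Complete quotients: \<open>Y\<^sub>n = \<lfloor>Y\<^sub>n\<rfloor> + 1/Y\<^sub>n\<^sub>+\<^sub>1\<close>.\<close>

primrec complete_quotient :: "complex fls \<Rightarrow> nat \<Rightarrow> complex fls" where
  "complete_quotient y 0 = y"
| "complete_quotient y (Suc n) =
     1 / (complete_quotient y n - at_infty (poly_part (complete_quotient y n)))"

definition curve_F :: "complex \<Rightarrow> complex \<Rightarrow> complex \<Rightarrow> complex poly" where
  "curve_F f u v = [:f, 0, 1:]^2 + Polynomial.smult (4 * u) [:- v, 1:]"

text \<open>The branch of \<open>Y\<close> at \<open>\<infinity>\<^sub>1\<close>, i.e. the root of \<open>Y^2 = F\<close> with \<open>Y \<sim> X^2\<close>.\<close>

definition is_branch_infty1 :: "complex poly \<Rightarrow> complex fls \<Rightarrow> bool" where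
  "is_branch_infty1 F Y \<longleftrightarrow> Y^2 = at_infty F \<and> fls_subdegree Y = -2 \<and> fls_nth Y (-2) = 1"

definition poly_P :: "complex \<Rightarrow> complex \<Rightarrow> complex poly" where
  "poly_P f d = [:f + 2 * d, 0, 1:]"

definition poly_Q :: "complex \<Rightarrow> complex \<Rightarrow> complex poly" where
  "poly_Q u v = Polynomial.smult u [:- v, 1:]"

text \<open>
  In the two recursions below the parameters \<open>u1 v0 v1 d0 d1 f\<close> are the values
  \<open>u\<^sub>1, v\<^sub>0, v\<^sub>1, d\<^sub>0, d\<^sub>1\<close> and the curve parameter \<open>f\<close>; \<open>Suc (Suc j)\<close> plays the role of the
  index, so the second sum of \<open>hankel_s\<close> is empty for index 2.
\<close>

fun hankel_s_tilde ::
  "complex \<Rightarrow> complex \<Rightarrow> complex \<Rightarrow> complex \<Rightarrow> complex \<Rightarrow> nat \<Rightarrow> complex" where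
  "hankel_s_tilde u1 v0 v1 d0 d1 0 = u1 / 2"
| "hankel_s_tilde u1 v0 v1 d0 d1 (Suc 0) = - (u1 / 2) * (v0 + v1)"
| "hankel_s_tilde u1 v0 v1 d0 d1 (Suc (Suc j)) =
     (- 2 * v0) * hankel_s_tilde u1 v0 v1 d0 d1 (Suc j)
     + (d0 - d1) * hankel_s_tilde u1 v0 v1 d0 d1 j
     + (d1 / (u1 / 2)) *
         (\<Sum>i\<le>j. hankel_s_tilde u1 v0 v1 d0 d1 i * hankel_s_tilde u1 v0 v1 d0 d1 (j - i))"

fun hankel_s :: "complex \<Rightarrow> complex \<Rightarrow> complex \<Rightarrow> complex \<Rightarrow> complex \<Rightarrow> nat \<Rightarrow> complex" where
  "hankel_s f u1 v0 v1 d1 0 = u1 / 2"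
| "hankel_s f u1 v0 v1 d1 (Suc 0) = - (u1 / 2) * v1"
| "hankel_s f u1 v0 v1 d1 (Suc (Suc j)) =
     - (2 * d1 + f) * hankel_s f u1 v0 v1 d1 j
     + inverse (u1 / 2) * d1 *
         ((\<Sum>i\<le>j. hankel_s f u1 v0 v1 d1 i * hankel_s f u1 v0 v1 d1 (j - i))
          - v0 * (\<Sum>i<j. hankel_s f u1 v0 v1 d1 i * hankel_s f u1 v0 v1 d1 (j - 1 - i)))"

text \<open>Indices of \<^const>\<open>mat\<close> start at 0, and the empty determinant is 1.\<close>

definition hankel_det :: "(nat \<Rightarrow> complex) \<Rightarrow> nat \<Rightarrow> complex" where
  "hankel_det s n = det (mat n n (\<lambda>(i, j). s (i + j)))"

end

theory Submission
  imports Defs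
begin

text \<open>
  Comparing coefficients in \<open>Y\<^sub>n\<^sub>+\<^sub>1 (Y\<^sub>n - a\<^sub>n) = 1\<close> gives
  \<open>d\<^sub>n + d\<^sub>n\<^sub>+\<^sub>1 + v\<^sub>n\<^sup>2 + f = 0\<close>, \<open>d\<^sub>n\<^sub>+\<^sub>1 (v\<^sub>n + v\<^sub>n\<^sub>+\<^sub>1) = u\<close> and
  \<open>d\<^sub>n\<^sub>+\<^sub>1 v\<^sub>n v\<^sub>n\<^sub>+\<^sub>1 = d\<^sub>n\<^sub>+\<^sub>1 (f + d\<^sub>n\<^sub>+\<^sub>1) + u v\<close>. Both moment sequences, divided by
  \<open>u\<^sub>1/2\<close>, are expansions of \<open>2/(u\<^sub>1 Y\<^sub>1)\<close>: in powers of \<open>1/X\<close> for \<open>s\<close>, and of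
  \<open>1/(X - v\<^sub>0)\<close> for the tilde version. In a shifted variable \<open>t = 1/(X - w)\<close> these expansions
  satisfy a quadratic equation whose form is preserved by one step
  \<open>m = 1 / (1 + (v\<^sub>k + w) t - d\<^sub>k\<^sub>+\<^sub>1 t\<^sup>2 m')\<close> of the J-fraction, and such a step multiplies Hankel
  determinants by powers of \<open>d\<^sub>k\<^sub>+\<^sub>1\<close> that do not depend on \<open>w\<close>. Hence \<open>D\<^sub>n = \<Delta>\<^sub>n\<close> and
  \<open>D\<^sub>n D\<^sub>n\<^sub>-\<^sub>2 = d\<^sub>n D\<^sub>n\<^sub>-\<^sub>1\<^sup>2\<close>, and the Somos relation reduces to
  \<open>d\<^sub>n\<^sub>-\<^sub>1 d\<^sub>n\<^sup>2 d\<^sub>n\<^sub>+\<^sub>1 = u\<^sup>2 d\<^sub>n + u\<^sup>2 (v\<^sup>2 + f)\<close>.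
\<close>

section \<open>Hankel determinants of moments of a J-fraction\<close>

text \<open>
  If the generating function of \<open>s\<close> is \<open>1 / (1 - b t - c t\<^sup>2 s'(t))\<close>, then
  \<open>(x s(x) - y s(y)) / (x - y) = s(x) s(y) (1 + c x y (x s'(x) - y s'(y)) / (x - y))\<close>;
  this is the same identity coefficientwise.
\<close>

lemma moment_add_index:
  fixes s s' :: "nat \<Rightarrow> 'a :: comm_ring_1"
  assumes s0: "s 0 = 1"
    and rec: "\<And>n. s (Suc n) = b * s n + c * (\<Sum>k<n. s (n - 1 - k) * s' k)"
  shows "s (i + j) = s i * s j + c * (\<Sum>k<i. \<Sum>l<j. s (i - 1 - k) * s (j - 1 - l) * s' (k + l))"
proof (induction i arbitrary: j)
  case 0
  then show ?case by (simp add: s0)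
next
  case (Suc i)
  define T where "T = (\<Sum>k<i. \<Sum>l<j. s (i - 1 - k) * s (j - 1 - l) * s' (Suc (k + l)))"
  define p where "p = (\<Sum>k<i. s (i - 1 - k) * s' k)"
  define q where "q = (\<Sum>l<j. s (j - 1 - l) * s' l)"
  have L: "(\<Sum>k<Suc i. \<Sum>l<j. s (i - k) * s (j - 1 - l) * s' (k + l)) = s i * q + T"
    unfolding T_def q_def
    by (subst sum.lessThan_Suc_shift) (simp add: sum_distrib_left mult.assoc)
  have R: "(\<Sum>k<i. \<Sum>l<Suc j. s (i - 1 - k) * s (j - l) * s' (k + l)) = s j * p + T"
    unfolding T_def p_def
    by (subst sum.lessThan_Suc_shift) (simp add: sum_distrib_left sum.distrib mult_ac)
  have "s (Suc i + j) = s (i + Suc j)" by simp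
  also have "\<dots> = s i * s (Suc j) + c * (s j * p + T)"
    using Suc.IH[of "Suc j"] R by simp
  also have "\<dots> = s (Suc i) * s j + c * (s i * q + T)"
    unfolding rec[of i] rec[of j] p_def[symmetric] q_def[symmetric] by (simp add: algebra_simps)
  finally show ?case using L by simp
qed

lemma hankel_det_0 [simp]: "hankel_det s 0 = 1"
  by (simp add: hankel_det_def)

lemma hankel_det_scale: "hankel_det (\<lambda>j. c * s j) n = c ^ n * hankel_det s n"
proof -
  have "mat n n (\<lambda>(i, j). c * s (i + j)) = c \<cdot>\<^sub>m mat n n (\<lambda>(i, j). s (i + j))"
    by (rule eq_matI) auto
  then show ?thesis by (simp add: hankel_det_def)
qed

text \<open>By \<open>moment_add_index\<close> the Hankel matrix of \<open>s\<close> factors as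
  \<open>L * K * transpose_mat L\<close>, where \<open>L\<close> is the lower triangular Toeplitz
  matrix of \<open>s\<close>, with unit diagonal, and \<open>K\<close> is block diagonal with blocks
  1 and \<open>c\<close> times the Hankel matrix of \<open>s'\<close>.\<close>

lemma hankel_det_Suc:
  assumes s0: "s 0 = 1"
    and rec: "\<And>n. s (Suc n) = b * s n + c * (\<Sum>k<n. s (n - 1 - k) * s' k)"
  shows "hankel_det s (Suc n) = c ^ n * hankel_det s' n"
proof -
  define L where "L = mat (Suc n) (Suc n) (\<lambda>(i, j). if j \<le> i then s (i - j) else 0)"
  define B where "B = c \<cdot>\<^sub>m mat n n (\<lambda>(i, j). s' (i + j))"
  define K where "K = four_block_mat (1\<^sub>m 1) (0\<^sub>m 1 n) (0\<^sub>m n 1) B"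
  have car: "L \<in> carrier_mat (Suc n) (Suc n)" "B \<in> carrier_mat n n"
    "K \<in> carrier_mat (Suc n) (Suc n)"
    by (auto simp: L_def B_def K_def)
  have K_nth: "K $$ (i, j) = (case (i, j) of (0, 0) \<Rightarrow> 1
      | (Suc k, Suc l) \<Rightarrow> c * s' (k + l) | _ \<Rightarrow> 0)" if "i < Suc n" "j < Suc n" for i j
    using that by (auto simp: K_def B_def split: nat.splits)
  define LK where "LK = L * K"
  have LK_car: "LK \<in> carrier_mat (Suc n) (Suc n)"
    using car by (simp add: LK_def)
  have LK: "LK $$ (i, j) = (case j of 0 \<Rightarrow> s i
      | Suc l \<Rightarrow> c * (\<Sum>k<i. s (i - 1 - k) * s' (k + l)))" if ij: "i < Suc n" "j < Suc n" for i j
  proof -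
    have "LK $$ (i, j) = (\<Sum>k<Suc n. L $$ (i, k) * K $$ (k, j))"
      using ij car by (auto simp: LK_def scalar_prod_def lessThan_atLeast0 intro!: sum.cong)
    also have "\<dots> = L $$ (i, 0) * K $$ (0, j) + (\<Sum>k<n. L $$ (i, Suc k) * K $$ (Suc k, j))"
      by (rule sum.lessThan_Suc_shift)
    also have "\<dots> = (case j of 0 \<Rightarrow> s i
      | Suc l \<Rightarrow> (\<Sum>k<n. if k < i then c * (s (i - 1 - k) * s' (k + l)) else 0))"
      using ij by (auto simp: K_nth L_def Suc_le_eq split: nat.splits intro!: sum.cong)
    also have "\<dots> = (case j of 0 \<Rightarrow> s i
      | Suc l \<Rightarrow> (\<Sum>k<i. c * (s (i - 1 - k) * s' (k + l))))"
    proof -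
      have "{..<n} \<inter> {k. k < i} = {..<i}" using ij by auto
      then show ?thesis by (simp add: sum.If_cases split: nat.splits)
    qed
    finally show ?thesis by (simp add: sum_distrib_left split: nat.splits)
  qed
  have "mat (Suc n) (Suc n) (\<lambda>(i, j). s (i + j)) = LK * transpose_mat L"
  proof (rule eq_matI, goal_cases)
    case (1 i j)
    then have ij: "i < Suc n" "j < Suc n" using car LK_car by auto
    have sub: "{..<n} \<inter> {l. l < j} = {..<j}" using ij by auto
    have "(LK * transpose_mat L) $$ (i, j) = (\<Sum>l<Suc n. LK $$ (i, l) * L $$ (j, l))"
      using ij LK_car car(1) by (auto simp: scalar_prod_def lessThan_atLeast0 simp del: sum.op_ivl_Suc
        intro!: sum.cong)
    also have "\<dots> = LK $$ (i, 0) * L $$ (j, 0) + (\<Sum>l<n. LK $$ (i, Suc l) * L $$ (j, Suc l))"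
      by (rule sum.lessThan_Suc_shift)
    also have "\<dots> = s i * s j + (\<Sum>l<n. if l < j
        then c * (\<Sum>k<i. s (i - 1 - k) * s' (k + l)) * s (j - 1 - l) else 0)"
      using ij by (auto simp: LK intro!: arg_cong2[of _ _ _ _ "(+)"] sum.cong)
        (auto simp: L_def Suc_le_eq)
    also have "\<dots> = s i * s j + (\<Sum>l<j. c * (\<Sum>k<i. s (i - 1 - k) * s' (k + l)) * s (j - 1 - l))"
      by (simp add: sum.If_cases sub)
    also have "\<dots> = s i * s j + c * (\<Sum>k<i. \<Sum>l<j. s (i - 1 - k) * s (j - 1 - l) * s' (k + l))"
      by (subst sum.swap[of _ "{..<j}"]) (simp add: sum_distrib_left sum_distrib_right mult_ac)
    also have "\<dots> = s (i + j)" using moment_add_index[of s, OF s0 rec] by simp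
    finally show ?case using ij by simp
  qed (use car LK_car in auto)
  moreover have "det L = 1"
    by (subst det_lower_triangular[OF _ car(1)]) (auto simp: L_def prod_list_diag_prod s0)
  moreover have "det K = c ^ n * hankel_det s' n"
  proof -
    have "det K = det (1\<^sub>m 1) * det B"
      unfolding K_def by (rule det_four_block_mat_upper_right_zero) (use car in auto)
    then show ?thesis by (simp add: B_def hankel_det_def)
  qed
  ultimately show ?thesis
    using car unfolding hankel_det_def LK_def
    by (simp add: det_mult[of _ "Suc n"] det_transpose)
qed

section \<open>The quadratic equation and its invariance under one step\<close>

text \<open>
  The equation \<open>(X\<^sup>2 + f + 2 d) M = (X - b) + d (X - a) M\<^sup>2\<close> in the variable \<open>t = 1/(X - w)\<close>, where
  \<open>M = t m(t)\<close>. For \<open>a = v\<^sub>k\<^sub>-\<^sub>1\<close>, \<open>b = v\<^sub>k\<close>, \<open>d = d\<^sub>k\<close> its solution is \<open>M = 2/(u\<^sub>k Y\<^sub>k)\<close>.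
\<close>

definition riccati :: "complex \<Rightarrow> complex \<Rightarrow> complex \<Rightarrow> complex \<Rightarrow> complex \<Rightarrow> complex fps \<Rightarrow> bool" where
  "riccati w f a b d m \<longleftrightarrow>
     (1 + fps_const (2 * w) * fps_X + fps_const (w^2 + f + 2 * d) * fps_X^2) * m
     = 1 + fps_const (w - b) * fps_X
       + fps_const d * fps_X^2 * (1 + fps_const (w - a) * fps_X) * m^2"

lemma riccati_nth:
  assumes "riccati w f a b d m"
  shows "fps_nth m 0 = 1" and "fps_nth m 1 = - (w + b)"
proof -
  let ?l = "\<lambda>k. fps_nth ((1 + fps_const (2 * w) * fps_X + fps_const (w^2 + f + 2 * d) * fps_X^2) * m) k"
  let ?r = "\<lambda>k. fps_nth (1 + fps_const (w - b) * fps_X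
       + fps_const d * fps_X^2 * (1 + fps_const (w - a) * fps_X) * m^2) k"
  have eq: "?l k = ?r k" for k
    using assms by (simp add: riccati_def)
  show 0: "fps_nth m 0 = 1"
    using eq[of 0] by simp
  have "?l 1 = fps_nth m 1 + 2 * w"
    by (simp add: fps_mult_nth 0 numeral_2_eq_2)
  moreover have "?r 1 = w - b"
    by (simp add: fps_mult_nth 0 numeral_2_eq_2)
  ultimately show "fps_nth m 1 = - (w + b)"
    using eq[of 1] by Groebner_Basis.algebra
qed

text \<open>Here \<open>D\<close> plays the role of \<open>d' * X^2 * m'\<close>. Multiplying
  \<open>r\<close> by \<open>N^2\<close> gives a quadratic equation for \<open>N\<close>; once
  \<open>N\<close> is expressed by \<open>D\<close>, the terms free of \<open>D\<close> collapse to
  \<open>- d' * X^2 * (1 + (w - c) * X)\<close>. The \<open>X^2\<close> coefficient comes from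
  \<open>dd\<close>, the \<open>X^3\<close> coefficient from \<open>dd\<close> and
  \<open>abc\<close>. The abstract ring keeps the constants atomic for the Groebner method.\<close>

lemma riccati_step_algebra:
  fixes w f a b c d d' X N D m :: "'a :: idom"
  assumes r: "(1 + 2 * w * X + (w^2 + f + 2 * d) * X^2) * m
      = 1 + (w - b) * X + d * X^2 * (1 + (w - a) * X) * m^2"
    and N: "m * N = 1" and D: "N = 1 + (w + b) * X - D"
    and dd: "d + d' + b^2 + f = 0" and abc: "d * (a + b) = d' * (b + c)"
  shows "(1 + 2 * w * X + (w^2 + f + 2 * d') * X^2) * D
      = d' * X^2 * (1 + (w - c) * X) + (1 + (w - b) * X) * D^2"
proof -
  have f: "f = - d - d' - b^2" using dd by Groebner_Basis.algebra
  have "(1 + 2 * w * X + (w^2 + f + 2 * d) * X^2) * N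
      = (1 + (w - b) * X) * N^2 + d * X^2 * (1 + (w - a) * X)"
    using r N by Groebner_Basis.algebra
  then show ?thesis
    unfolding D f using abc by Groebner_Basis.algebra
qed

text \<open>The reciprocal of \<open>m\<close> begins with \<open>1 + (w + b) * X\<close>, so the
  deviation \<open>E\<close> from this linear part has order at least 2 and can be divided by
  \<open>d' * X^2\<close>. The quotient is the next series.\<close>

lemma riccati_step:
  assumes r: "riccati w f a b d m"
    and dd: "d + d' + b^2 + f = 0" and abc: "d * (a + b) = d' * (b + c)" and d': "d' \<noteq> 0"
  obtains m' where "riccati w f b c d' m'"
    and "m * (1 + fps_const (w + b) * fps_X - fps_const d' * fps_X^2 * m') = 1"
proof -
  define N where "N = inverse m"
  define E where "E = 1 + fps_const (w + b) * fps_X - N"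
  define m' where "m' = fps_const (inverse d') * fps_shift 2 E"
  note m01 = riccati_nth[OF r]
  have mN: "m * N = 1"
    unfolding N_def using m01(1) by (simp add: inverse_mult_eq_1')
  have N0: "fps_nth N 0 = 1"
    using arg_cong[OF mN, of "\<lambda>g. fps_nth g 0"] m01 by simp
  have "fps_nth N 1 + fps_nth m 1 = 0"
    using arg_cong[OF mN, of "\<lambda>g. fps_nth g 1"] m01(1) N0 by (simp add: fps_mult_nth)
  then have N1: "fps_nth N 1 = w + b"
    unfolding m01(2) by Groebner_Basis.algebra
  have E01: "fps_nth E 0 = 0" "fps_nth E (Suc 0) = 0"
    using N0 N1 by (simp_all add: E_def)
  have "fps_X^2 * fps_shift 2 E = E"
  proof (rule fps_ext)
    fix n
    have "n = 0 \<or> n = Suc 0 \<or> (\<exists>k. n = Suc (Suc k))" by presburger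
    then show "fps_nth (fps_X^2 * fps_shift 2 E) n = fps_nth E n"
      using E01 by (auto simp: power2_eq_square mult.assoc)
  qed
  moreover have "fps_const d' * fps_const (inverse d') = 1"
    using d' by simp
  moreover have "fps_const d' * fps_X^2 * m'
      = (fps_const d' * fps_const (inverse d')) * (fps_X^2 * fps_shift 2 E)"
    unfolding m'_def by (simp only: mult_ac)
  ultimately have D: "fps_const d' * fps_X^2 * m' = E"
    by simp
  have mm: "m * (1 + fps_const (w + b) * fps_X - fps_const d' * fps_X^2 * m') = 1"
    using mN unfolding D by (simp add: E_def)
  have hom: "fps_const (x + y) = fps_const x + fps_const y" "fps_const (x - y) = fps_const x - fps_const y"
    "fps_const (x * y) = fps_const x * fps_const y" "fps_const (x ^ n) = fps_const x ^ n"
    "fps_const (numeral k) = numeral k" for x y :: complex and n k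
    by (simp_all add: fps_const_power numeral_fps_const)
  have "(1 + 2 * fps_const w * fps_X + (fps_const w^2 + fps_const f + 2 * fps_const d') * fps_X^2) * E
      = fps_const d' * fps_X^2 * (1 + (fps_const w - fps_const c) * fps_X)
        + (1 + (fps_const w - fps_const b) * fps_X) * E^2"
  proof (rule riccati_step_algebra[OF _ mN])
    show "(1 + 2 * fps_const w * fps_X + (fps_const w^2 + fps_const f + 2 * fps_const d) * fps_X^2) * m
      = 1 + (fps_const w - fps_const b) * fps_X
        + fps_const d * fps_X^2 * (1 + (fps_const w - fps_const a) * fps_X) * m^2"
      using r unfolding riccati_def hom by simp
    show "N = 1 + (fps_const w + fps_const b) * fps_X - E"
      by (simp add: E_def)
    show "fps_const d + fps_const d' + fps_const b^2 + fps_const f = 0"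
      using arg_cong[OF dd, of fps_const] unfolding hom by simp
    show "fps_const d * (fps_const a + fps_const b) = fps_const d' * (fps_const b + fps_const c)"
      using arg_cong[OF abc, of fps_const] unfolding hom by simp
  qed
  \<comment> \<open>With \<open>E\<close> written as \<open>d' * X^2 * m'\<close>, every term
    contains the nonzero factor \<open>d' * X^2\<close>, which is then cancelled.\<close>
  then have "(fps_const d' * fps_X^2) *
      ((1 + 2 * fps_const w * fps_X + (fps_const w^2 + fps_const f + 2 * fps_const d') * fps_X^2) * m')
    = (fps_const d' * fps_X^2) * (1 + (fps_const w - fps_const c) * fps_X
        + fps_const d' * fps_X^2 * (1 + (fps_const w - fps_const b) * fps_X) * m'^2)"
    unfolding D[symmetric] by Groebner_Basis.algebra
  then have "riccati w f b c d' m'"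
    using d' unfolding riccati_def hom by simp
  then show thesis using mm that by blast
qed

section \<open>Generating functions of the two moment sequences\<close>

lemma fps_quadratic_nth:
  fixes a b :: "'a :: idom"
  shows "fps_nth ((1 + fps_const a * fps_X + fps_const b * fps_X^2) * g) 0 = fps_nth g 0"
    and "fps_nth ((1 + fps_const a * fps_X + fps_const b * fps_X^2) * g) (Suc 0)
      = fps_nth g (Suc 0) + a * fps_nth g 0"
    and "fps_nth ((1 + fps_const a * fps_X + fps_const b * fps_X^2) * g) (Suc (Suc n))
      = fps_nth g (Suc (Suc n)) + a * fps_nth g (Suc n) + b * fps_nth g n"
proof -
  have eq: "(1 + fps_const a * fps_X + fps_const b * fps_X^2) * g
      = g + fps_const a * (fps_X * g) + fps_const b * (fps_X * (fps_X * g))"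
    by Groebner_Basis.algebra
  show "fps_nth ((1 + fps_const a * fps_X + fps_const b * fps_X^2) * g) 0 = fps_nth g 0"
    "fps_nth ((1 + fps_const a * fps_X + fps_const b * fps_X^2) * g) (Suc 0)
      = fps_nth g (Suc 0) + a * fps_nth g 0"
    "fps_nth ((1 + fps_const a * fps_X + fps_const b * fps_X^2) * g) (Suc (Suc n))
      = fps_nth g (Suc (Suc n)) + a * fps_nth g (Suc n) + b * fps_nth g n"
    unfolding eq by simp_all
qed

text \<open>The moment sequences start with \<open>u1 / 2\<close>, while solutions of
  \<open>riccati\<close> start with 1; normalizing by \<open>c\<close> moves a factor
  \<open>c\<close> into the quadratic term.\<close>

lemma riccati_scale:
  assumes c: "c \<noteq> 0"
    and g: "(1 + fps_const (2 * w) * fps_X + fps_const (w^2 + f + 2 * d) * fps_X^2) * g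
     = fps_const c * (1 + fps_const (w - b) * fps_X)
       + fps_const (d / c) * (fps_X^2 * (1 + fps_const (w - a) * fps_X) * g^2)"
  shows "riccati w f a b d (fps_const (inverse c) * g)"
proof -
  have c1: "fps_const c * fps_const (inverse c) = 1"
    using c by simp
  have dc: "fps_const (d / c) = fps_const d * fps_const (inverse c)"
    by (simp add: field_simps)
  show ?thesis
    using g c1 unfolding riccati_def dc by Groebner_Basis.algebra
qed

lemma riccati_hankel_s:
  assumes u1: "u1 \<noteq> 0"
  shows "riccati 0 f v0 v1 d1 (Abs_fps (\<lambda>j. inverse (u1 / 2) * hankel_s f u1 v0 v1 d1 j))"
proof -
  define s where "s = hankel_s f u1 v0 v1 d1"
  define g where "g = Abs_fps s"
  have gg: "fps_nth (g^2) n = (\<Sum>i\<le>n. s i * s (n - i))" for n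
    by (simp add: g_def power2_eq_square fps_mult_nth atLeast0AtMost)
  have X2: "fps_X^2 * (1 + fps_const (0 - v0) * fps_X) * g^2
      = fps_X * (fps_X * g^2) + fps_const (0 - v0) * (fps_X * (fps_X * (fps_X * g^2)))"
    by Groebner_Basis.algebra
  have "(1 + fps_const (2 * 0) * fps_X + fps_const (0^2 + f + 2 * d1) * fps_X^2) * g
     = fps_const (u1 / 2) * (1 + fps_const (0 - v1) * fps_X)
       + fps_const (d1 / (u1 / 2)) * (fps_X^2 * (1 + fps_const (0 - v0) * fps_X) * g^2)"
    unfolding X2
  proof (rule fps_ext)
    fix n
    \<comment> \<open>Index 2 is separate: the term with \<open>v0\<close> carries
      \<open>X^3\<close>, so it first contributes at index 3, in accordance with the empty second
      sum.\<close>
    have "n = 0 \<or> n = Suc 0 \<or> n = 2 \<or> (\<exists>k. n = Suc (Suc (Suc k)))" by presburger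
    then show "fps_nth ((1 + fps_const (2 * 0) * fps_X + fps_const (0^2 + f + 2 * d1) * fps_X^2) * g) n
       = fps_nth (fps_const (u1 / 2) * (1 + fps_const (0 - v1) * fps_X)
         + fps_const (d1 / (u1 / 2)) * (fps_X * (fps_X * g^2)
         + fps_const (0 - v0) * (fps_X * (fps_X * (fps_X * g^2))))) n"
    proof (elim disjE exE)
      assume "n = 2"
      then show ?thesis unfolding numeral_2_eq_2
        by (simp add: fps_quadratic_nth gg) (simp add: g_def s_def field_simps)
    next
      fix k assume "n = Suc (Suc (Suc k))"
      then show ?thesis
        by (simp only: fps_quadratic_nth)
          (simp add: gg, simp add: g_def s_def lessThan_Suc_atMost field_simps)
    qed (simp_all add: fps_quadratic_nth, simp_all add: g_def s_def)
  qed
  then have "riccati 0 f v0 v1 d1 (fps_const (inverse (u1 / 2)) * g)"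
    by (rule riccati_scale[rotated]) (use u1 in simp)
  also have "fps_const (inverse (u1 / 2)) * g = Abs_fps (\<lambda>j. inverse (u1 / 2) * s j)"
    by (rule fps_ext) (simp add: g_def)
  finally show ?thesis by (simp add: s_def)
qed

text \<open>For the shift \<open>w = v0\<close> the factor \<open>1 + (w - a) * X\<close> with
  \<open>a = v0\<close> becomes 1, which leaves a single convolution in the recursion;
  \<open>d01\<close> turns \<open>v0^2 + f + 2 * d1\<close> into \<open>d1 - d0\<close>.\<close>

lemma riccati_hankel_s_tilde:
  assumes u1: "u1 \<noteq> 0" and d01: "d0 + d1 + v0^2 + f = 0"
  shows "riccati v0 f v0 v1 d1 (Abs_fps (\<lambda>j. inverse (u1 / 2) * hankel_s_tilde u1 v0 v1 d0 d1 j))"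
proof -
  define s where "s = hankel_s_tilde u1 v0 v1 d0 d1"
  define g where "g = Abs_fps s"
  have gg: "fps_nth (g^2) n = (\<Sum>i\<le>n. s i * s (n - i))" for n
    by (simp add: g_def power2_eq_square fps_mult_nth atLeast0AtMost)
  have b: "v0^2 + f + 2 * d1 = d1 - d0"
    using d01 by Groebner_Basis.algebra
  have X2: "fps_X^2 * (1 + fps_const (v0 - v0) * fps_X) * g^2 = fps_X * (fps_X * g^2)"
    by (simp add: power2_eq_square mult.assoc)
  have "(1 + fps_const (2 * v0) * fps_X + fps_const (v0^2 + f + 2 * d1) * fps_X^2) * g
     = fps_const (u1 / 2) * (1 + fps_const (v0 - v1) * fps_X)
       + fps_const (d1 / (u1 / 2)) * (fps_X^2 * (1 + fps_const (v0 - v0) * fps_X) * g^2)"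
    unfolding X2 b
  proof (rule fps_ext)
    fix n
    have "n = 0 \<or> n = Suc 0 \<or> (\<exists>k. n = Suc (Suc k))" by presburger
    then show "fps_nth ((1 + fps_const (2 * v0) * fps_X + fps_const (d1 - d0) * fps_X^2) * g) n
       = fps_nth (fps_const (u1 / 2) * (1 + fps_const (v0 - v1) * fps_X)
         + fps_const (d1 / (u1 / 2)) * (fps_X * (fps_X * g^2))) n"
    proof (elim disjE exE)
      fix k assume "n = Suc (Suc k)"
      then show ?thesis
        by (simp add: fps_quadratic_nth gg) (simp add: g_def s_def field_simps)
    qed (simp_all add: fps_quadratic_nth, simp_all add: g_def s_def field_simps)
  qed
  then have "riccati v0 f v0 v1 d1 (fps_const (inverse (u1 / 2)) * g)"
    by (rule riccati_scale[rotated]) (use u1 in simp)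
  also have "fps_const (inverse (u1 / 2)) * g = Abs_fps (\<lambda>j. inverse (u1 / 2) * s j)"
    by (rule fps_ext) (simp add: g_def)
  finally show ?thesis by (simp add: s_def)
qed

section \<open>Expansions at infinity and the branch of the curve\<close>

lemma at_infty_0 [simp]: "at_infty 0 = 0"
  by (simp add: at_infty_def)

lemma at_infty_pCons [simp]: "at_infty (pCons a p) = fls_const a + fls_X_inv * at_infty p"
  by (simp add: at_infty_def map_poly_pCons)

lemma fls_const_hom:
  fixes x y :: "'a :: comm_ring_1"
  shows "fls_const (x + y) = fls_const x + fls_const y" "fls_const (x - y) = fls_const x - fls_const y"
    "fls_const (x * y) = fls_const x * fls_const y" "fls_const (x ^ n) = fls_const x ^ n"
    "fls_const (- x) = - fls_const x" "fls_const (numeral k) = numeral k"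
  by (simp_all add: fls_const_power fls_const_mult_const fls_plus_const fls_minus_const
    fls_const_numeral)

lemma at_infty_poly_P: "at_infty (poly_P f d) = fls_X_inv^2 + fls_const (f + 2 * d)"
  by (simp add: poly_P_def power2_eq_square)

lemma at_infty_poly_Q: "at_infty (poly_Q u v) = fls_const u * (fls_X_inv - fls_const v)"
proof -
  have Q: "poly_Q u v = [:- (u * v), u:]"
    by (simp add: poly_Q_def)
  show ?thesis
    unfolding Q at_infty_pCons at_infty_0 fls_const_hom by Groebner_Basis.algebra
qed

lemma at_infty_curve_F:
  "at_infty (curve_F f u v)
   = (fls_X_inv^2 + fls_const f)^2 + fls_const (4 * u) * (fls_X_inv - fls_const v)"
proof -
  have F: "curve_F f u v = [:f^2 - 4 * u * v, 4 * u, 2 * f, 0, 1:]"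
    by (simp add: curve_F_def power2_eq_square)
  show ?thesis
    unfolding F at_infty_pCons at_infty_0 fls_const_hom fls_const_0 fls_const_1 by Groebner_Basis.algebra
qed

lemma fls_X_inv_sq_nth: "fls_nth (fls_X_inv^2 :: 'a :: comm_ring_1 fls) k = (if k = -2 then 1 else 0)"
  by (simp add: power2_eq_square fls_X_inv_times_conv_shift)

lemma fls_subdegree_linear: "fls_subdegree (fls_X_inv - fls_const (a :: complex)) = -1"
  by (rule fls_subdegree_eqI) auto

text \<open>The product of \<open>W\<close> and \<open>Y + X^2 + f\<close> is
  \<open>F - (X^2 + f)^2\<close>, of degree at most 1 in \<open>X\<close>, and the second factor has
  degree 2. Hence \<open>W\<close> has only negative powers of \<open>X\<close>, and the coefficient
  of \<open>X\<close> in the product gives its leading term.\<close>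

lemma branch_remainder:
  assumes "is_branch_infty1 (curve_F f u v) Y"
  obtains W where "Y = fls_X_inv^2 + fls_const f + W"
    and "W * (W + 2 * (fls_X_inv^2 + fls_const f)) = fls_const (4 * u) * (fls_X_inv - fls_const v)"
    and "\<And>k. k \<le> 0 \<Longrightarrow> fls_nth W k = 0" and "fls_nth W 1 = 2 * u"
proof -
  from assms have Y: "Y^2 = at_infty (curve_F f u v)" "fls_subdegree Y = -2" "fls_nth Y (-2) = 1"
    by (auto simp: is_branch_infty1_def)
  define W where "W = Y - fls_X_inv^2 - fls_const f"
  have eq: "W * (W + 2 * (fls_X_inv^2 + fls_const f)) = fls_const (4 * u) * (fls_X_inv - fls_const v)"
    using Y(1) unfolding W_def at_infty_curve_F by Groebner_Basis.algebra
  have WY: "W + 2 * (fls_X_inv^2 + fls_const f) = Y + fls_X_inv^2 + fls_const f"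
    by (simp add: W_def)
  have sub: "fls_subdegree (W + 2 * (fls_X_inv^2 + fls_const f)) = -2"
    unfolding WY using Y by (intro fls_subdegree_eqI) (auto simp: fls_X_inv_sq_nth)
  then have ne: "W + 2 * (fls_X_inv^2 + fls_const f) \<noteq> 0"
    by auto
  have W0: "fls_nth W k = 0" if "k \<le> 0" for k
  \<comment> \<open>The zero series has subdegree 0 by convention, so counting degrees is valid only
    for nonzero \<open>u\<close>.\<close>
  proof (cases "u = 0")
    case True
    then have "W = 0" using eq ne by simp
    then show ?thesis by simp
  next
    case False
    have lin: "fls_X_inv - fls_const v \<noteq> 0"
      using fls_subdegree_linear[of v] by auto
    then have "W \<noteq> 0" using eq False by auto
    then have "fls_subdegree W - 2 = fls_subdegree (W * (W + 2 * (fls_X_inv^2 + fls_const f)))"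
      using ne sub by simp
    also have "\<dots> = -1"
      unfolding eq using False lin by (simp add: fls_subdegree_linear)
    finally show ?thesis using that by simp
  qed
  have "W * (W + 2 * (fls_X_inv^2 + fls_const f))
      = W * W + 2 * (fls_X_inv * (fls_X_inv * W)) + fls_const (2 * f) * W"
    unfolding fls_const_hom by Groebner_Basis.algebra
  then have "fls_nth (W * W + 2 * (fls_X_inv * (fls_X_inv * W)) + fls_const (2 * f) * W) (-1)
      = fls_nth (fls_const (4 * u) * (fls_X_inv - fls_const v)) (-1)"
    using eq by simp
  moreover have "fls_nth (W * W) (-1) = 0"
  proof (cases "W = 0")
    case False
    then have "fls_subdegree W \<ge> 1"
      by (rule fls_subdegree_geI) (use W0 in auto)
    then show ?thesis by (intro fls_times_nth_eq0) auto
  qed simp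
  ultimately have "fls_nth W 1 = 2 * u"
    using W0[of "-1"] by (simp add: fls_X_inv_times_conv_shift(1))
  moreover have "Y = fls_X_inv^2 + fls_const f + W"
    by (simp add: W_def)
  ultimately show thesis using that eq W0 by blast
qed

section \<open>Relations between consecutive complete quotients\<close>

lemma poly_part_linear:
  assumes "\<And>k. k \<le> 0 \<Longrightarrow> fls_nth z k = 0"
  shows "poly_part (at_infty [:a, b:] + z) = [:a, b:]"
proof (rule poly_eqI)
  fix n
  show "coeff (poly_part (at_infty [:a, b:] + z)) n = coeff [:a, b:] n"
    using assms[of "- int n"]
    by (auto simp: poly_part_def coeff_pCons fls_X_inv_times_conv_shift split: nat.splits)
qed

text \<open>Dividing \<open>Y + P\<close> by \<open>Q\<close> gives the partial quotient
  \<open>2 * (X + b) / U\<close> and the remainder \<open>N = W + 2 * e\<close>. The step then says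
  \<open>N * (Y + P') = Q * Q'\<close>; the equation for \<open>W\<close> removes its square, and
  comparing coefficients yields the four claims.\<close>

lemma continued_fraction_step:
  fixes f u v :: complex
  assumes Y: "is_branch_infty1 (curve_F f u v) Y"
    and y: "y = (Y + at_infty (poly_P f d)) / at_infty (poly_Q U b)"
    and step: "1 / (y - at_infty (poly_part y)) = (Y + at_infty (poly_P f d')) / at_infty (poly_Q U' b')"
    and U: "U \<noteq> 0" "U' \<noteq> 0"
  shows "4 * (f + d + b^2) = U * U'"
    and "4 * u = - U * U' * (b + b')"
    and "4 * (f + d + b^2) * (f + d') - 4 * u * v = U * U' * b * b'"
    and "u * (d' + (f + d + b^2)) = 0"
proof -
  obtain W where W: "Y = fls_X_inv^2 + fls_const f + W"
      "W * (W + 2 * (fls_X_inv^2 + fls_const f)) = fls_const (4 * u) * (fls_X_inv - fls_const v)"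
      "\<And>k. k \<le> 0 \<Longrightarrow> fls_nth W k = 0" "fls_nth W 1 = 2 * u"
    using branch_remainder[OF Y] by blast
  define e where "e = f + d + b^2"
  define X :: "complex fls" where "X = fls_X_inv"
  define Q where "Q = fls_const U * (X - fls_const b)"
  define Q' where "Q' = fls_const U' * (X - fls_const b')"
  define P' where "P' = X^2 + fls_const (f + 2 * d')"
  have sub: "fls_subdegree (X - fls_const c) = -1" for c
    unfolding X_def by (rule fls_subdegree_linear)
  have lin: "X - fls_const c \<noteq> 0" for c
    using sub[of c] by auto
  have Q: "Q \<noteq> 0" "Q' \<noteq> 0" "fls_subdegree Q = -1"
    using lin U sub by (auto simp: Q_def Q'_def)
  define N where "N = W + fls_const (2 * e)"
  define z where "z = N / Q"
  have z0: "fls_nth z k = 0" if "k \<le> 0" for k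
  proof (cases "z = 0")
    case False
    then have N: "N \<noteq> 0" by (auto simp: z_def)
    have "N = z * Q" using Q by (simp add: z_def)
    then have "fls_subdegree N = fls_subdegree z - 1"
      using False Q by simp
    moreover have "fls_subdegree N \<ge> 0"
      using N by (rule fls_subdegree_geI) (auto simp: N_def W(3))
    ultimately show ?thesis using that by simp
  qed simp
  have UU: "fls_const U * fls_const (1 / U) = 1"
    using U by (simp add: fls_const_mult_const)
  have "y = at_infty [:2 * b / U, 2 / U:] + z"
  proof -
    have a: "at_infty [:2 * b / U, 2 / U:] = fls_const (1 / U) * 2 * (fls_const b + X)"
    proof -
      have "2 * b / U = 1 / U * 2 * b" "2 / U = 1 / U * 2" by simp_all
      then show ?thesis
        by (simp only: at_infty_pCons at_infty_0 fls_const_hom X_def) Groebner_Basis.algebra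
    qed
    have "Y + at_infty (poly_P f d) = (at_infty [:2 * b / U, 2 / U:] + z) * Q"
    proof -
      have "z * Q = N" using Q by (simp add: z_def)
      moreover have "Y + at_infty (poly_P f d) = fls_const (1 / U) * 2 * (fls_const b + X) * Q + N"
        unfolding W(1) at_infty_poly_P X_def[symmetric] Q_def N_def e_def fls_const_hom using UU by Groebner_Basis.algebra
      ultimately show ?thesis unfolding a by (simp only: distrib_right)
    qed
    then show ?thesis unfolding y using Q by (simp add: at_infty_poly_Q Q_def[unfolded X_def])
  qed
  then have "y - at_infty (poly_part y) = z"
    using poly_part_linear[OF z0] by simp
  then have z_inv: "1 / z = (Y + P') / Q'"
    using step unfolding at_infty_poly_P at_infty_poly_Q P'_def Q'_def X_def by simp
  \<comment> \<open>The leading coefficient 2 makes \<open>1 / z\<close> nonzero, which rules out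
    \<open>z = 0\<close> because \<open>1 / 0 = 0\<close>.\<close>
  have "fls_nth (Y + P') (-2) = 2"
    unfolding W(1) P'_def X_def using W(3)[of "-2"] by (simp add: fls_X_inv_sq_nth)
  then have "Y + P' \<noteq> 0" by (metis fls_zero_nth zero_neq_numeral)
  then have "z \<noteq> 0" using z_inv Q by auto
  then have "Y + P' = Q' / z"
    using z_inv Q by (metis nonzero_mult_div_cancel_left times_divide_eq_right mult.right_neutral)
  moreover have "N = z * Q"
    using Q by (simp add: z_def)
  ultimately have "N * (Y + P') = Q * Q'"
    using \<open>z \<noteq> 0\<close> by simp
  have "fls_const (4 * u) * X - fls_const (4 * u * v) + fls_const (2 * (d' + e)) * W
        + fls_const (4 * e) * X^2 + fls_const (4 * e * (f + d'))
      = fls_const (U * U') * X^2 - fls_const (U * U' * (b + b')) * X + fls_const (U * U' * b * b')"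
  proof -
    have "N * (Y + P') = W * (W + 2 * (X^2 + fls_const f)) + fls_const (2 * (d' + e)) * W
        + fls_const (4 * e) * X^2 + fls_const (4 * e * (f + d'))"
      unfolding N_def P'_def W(1) X_def[symmetric] fls_const_hom by (simp add: algebra_simps power2_eq_square)
    moreover have "Q * Q' = fls_const (U * U') * X^2 - fls_const (U * U' * (b + b')) * X
        + fls_const (U * U' * b * b')"
      unfolding Q_def Q'_def fls_const_hom by (simp add: algebra_simps power2_eq_square)
    moreover have "W * (W + 2 * (X^2 + fls_const f)) = fls_const (4 * u) * X - fls_const (4 * u * v)"
      using W(2) unfolding X_def fls_const_hom by (simp add: algebra_simps)
    ultimately show ?thesis
      using \<open>N * (Y + P') = Q * Q'\<close> by simp
  qed
  then have nth: "fls_nth (fls_const (4 * u) * X - fls_const (4 * u * v) + fls_const (2 * (d' + e)) * W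
        + fls_const (4 * e) * X^2 + fls_const (4 * e * (f + d'))) k
      = fls_nth (fls_const (U * U') * X^2 - fls_const (U * U' * (b + b')) * X + fls_const (U * U' * b * b')) k" for k
    by simp
  \<comment> \<open>The orders -2, -1, 0, 1 are the coefficients of \<open>X^2\<close>,
    \<open>X\<close>, 1 and \<open>1/X\<close>; \<open>W\<close> enters only at the last one,
    through its leading coefficient \<open>2 * u\<close>.\<close>
  show "4 * (f + d + b^2) = U * U'"
    using nth[of "-2"] W(3)[of "-2"] by (simp add: X_def fls_X_inv_sq_nth e_def)
  show "4 * u = - U * U' * (b + b')"
    using nth[of "-1"] W(3)[of "-1"] by (simp add: X_def fls_X_inv_sq_nth)
  show "4 * (f + d + b^2) * (f + d') - 4 * u * v = U * U' * b * b'"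
    using nth[of 0] W(3)[of 0] by (simp add: X_def fls_X_inv_sq_nth e_def)
  show "u * (d' + (f + d + b^2)) = 0"
  proof -
    have "2 * d' + 2 * e = 0 \<or> u = 0"
      using nth[of 1] W(4) by (simp add: X_def fls_X_inv_sq_nth)
    then have "2 * (d' + e) = 0 \<or> u = 0"
      by (simp only: distrib_left)
    then show ?thesis
      unfolding e_def by (metis mult_eq_0_iff zero_neq_numeral)
  qed
qed

lemma continued_fraction_relations:
  fixes f u v :: complex and us vs d :: "nat \<Rightarrow> complex"
  assumes Y: "is_branch_infty1 (curve_F f u v) Y"
    and Yn: "\<And>n. complete_quotient
                   ((Y + at_infty (poly_P f (d 0))) / at_infty (poly_Q (us 0) (vs 0))) n
                 = (Y + at_infty (poly_P f (d n))) / at_infty (poly_Q (us n) (vs n))"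
    and us_nz: "\<And>n. us n \<noteq> 0"
  shows "d n + d (Suc n) + (vs n)^2 + f = 0"
    and "d (Suc n) * (vs n + vs (Suc n)) = u"
    and "d (Suc n) * (vs n * vs (Suc n)) = d (Suc n) * (f + d (Suc n)) + u * v"
proof -
  define y where "y n = (Y + at_infty (poly_P f (d n))) / at_infty (poly_Q (us n) (vs n))" for n
  have "1 / (y n - at_infty (poly_part (y n))) = y (Suc n)" for n
    using Yn[of n] Yn[of "Suc n"] by (simp add: y_def)
  note step = continued_fraction_step[OF Y y_def this[unfolded y_def[of "Suc _"]] us_nz us_nz]
  \<comment> \<open>For \<open>u = 0\<close> the curve splits, \<open>Y\<^sub>0\<close> is rational and the continued fraction terminates.\<close>
  have u: "u \<noteq> 0"
  proof
    assume u: "u = 0"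
    have b: "vs 0 + vs 1 = 0"
      using step(2)[of 0] us_nz u by simp
    have "4 * (f + d 0 + (vs 0)^2) \<noteq> 0"
      unfolding step(1) using us_nz by simp
    moreover have "4 * (f + d 0 + (vs 0)^2) * (f + d 1) = 4 * (f + d 0 + (vs 0)^2) * (vs 0 * vs 1)"
      using step(3)[of 0] step(1)[of 0] u by (simp add: mult.assoc)
    ultimately have "f + d 1 = vs 0 * vs 1"
      by (rule mult_left_cancel[THEN iffD1])
    moreover have "vs 0 = - vs 1" using b by (simp add: eq_neg_iff_add_eq_0)
    \<comment> \<open>The left side is a quarter of \<open>us 1 * us 2\<close> by the next step, so
      it cannot vanish.\<close>
    ultimately have "f + d 1 + (vs 1)^2 = 0" by (simp add: power2_eq_square)
    then show False using step(1)[of 1] us_nz[of 1] us_nz[of "Suc 1"] by simp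
  qed
  have e: "f + d n + (vs n)^2 = - d (Suc n)"
    using step(4)[of n] u by (simp add: eq_neg_iff_add_eq_0 add_ac)
  show "d n + d (Suc n) + (vs n)^2 + f = 0"
    using e by Groebner_Basis.algebra
  have UU: "us n * us (Suc n) = - 4 * d (Suc n)"
    using step(1)[of n] unfolding e by simp
  have "4 * (d (Suc n) * (vs n + vs (Suc n))) = 4 * u"
    using step(2)[of n] unfolding minus_mult_left[symmetric] UU by Groebner_Basis.algebra
  then show "d (Suc n) * (vs n + vs (Suc n)) = u"
    by (rule mult_left_cancel[THEN iffD1, rotated]) simp
  have "4 * (d (Suc n) * (vs n * vs (Suc n))) = 4 * (d (Suc n) * (f + d (Suc n)) + u * v)"
    using step(3)[of n] unfolding e UU by (simp add: algebra_simps)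
  then show "d (Suc n) * (vs n * vs (Suc n)) = d (Suc n) * (f + d (Suc n)) + u * v"
    by (rule mult_left_cancel[THEN iffD1, rotated]) simp
qed

section \<open>The Somos relation and the evaluation of the determinants\<close>

text \<open>With \<open>g = f + d'\<close> this rests on
  \<open>(g + a^2) * (g + b^2) = (g - a * b)^2 + g * (a + b)^2\<close>, where the left side is
  \<open>d * d''\<close>.\<close>

lemma somos_product:
  fixes d d' d'' a b f u v :: complex
  assumes "d + d' + a^2 + f = 0" "d' + d'' + b^2 + f = 0"
    and "d' * (a + b) = u" "d' * (a * b) = d' * (f + d') + u * v"
  shows "d * d'^2 * d'' = u^2 * d' + u^2 * (v^2 + f)"
proof -
  have d: "d = - d' - a^2 - f" "d'' = - d' - b^2 - f"
    using assms(1,2) by Groebner_Basis.algebra+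
  have "d * d'^2 * d'' = (d' * (f + d') - d' * (a * b))^2 + (f + d') * (d' * (a + b))^2"
    unfolding d by Groebner_Basis.algebra
  then show ?thesis unfolding assms(3,4) by Groebner_Basis.algebra
qed

lemma hankel_det_riccati_step:
  assumes r: "riccati w f a b d m"
    and dd: "d + d' + b^2 + f = 0" and abc: "d * (a + b) = d' * (b + c)" and d': "d' \<noteq> 0"
  obtains m' where "riccati w f b c d' m'"
    and "\<And>n. hankel_det (fps_nth m) (Suc n) = d' ^ n * hankel_det (fps_nth m') n"
proof -
  obtain m' where m': "riccati w f b c d' m'"
    and eq: "m * (1 + fps_const (w + b) * fps_X - fps_const d' * fps_X^2 * m') = 1"
    using riccati_step[OF assms] by blast
  \<comment> \<open>The extra factor \<open>X\<close> makes coefficient \<open>n\<close> of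
    \<open>q\<close> the convolution over \<open>k < n\<close> that \<open>hankel_det_Suc\<close>
    expects.\<close>
  define q where "q = fps_X * (m' * m)"
  have m: "m + fps_const (w + b) * (fps_X * m) = 1 + fps_const d' * (fps_X * q)"
    using eq unfolding q_def by Groebner_Basis.algebra
  have q: "fps_nth q n = (\<Sum>k<n. fps_nth m (n - 1 - k) * fps_nth m' k)" for n
  proof (cases n)
    case (Suc k)
    then have "fps_nth q n = fps_nth (m' * m) k" by (simp add: q_def)
    also have "\<dots> = (\<Sum>i\<le>k. fps_nth m' i * fps_nth m (k - i))"
      by (simp only: fps_mult_nth atLeast0AtMost)
    finally show ?thesis
      by (simp add: Suc lessThan_Suc_atMost mult.commute)
  qed (simp add: q_def)
  have rec: "fps_nth m (Suc n) = - (w + b) * fps_nth m n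
      + d' * (\<Sum>k<n. fps_nth m (n - 1 - k) * fps_nth m' k)" for n
  proof -
    have "fps_nth m (Suc n) + (w + b) * fps_nth m n = d' * fps_nth q n"
      using arg_cong[OF m, of "\<lambda>g. fps_nth g (Suc n)"] by simp
    then show ?thesis
      unfolding q by (simp add: algebra_simps)
  qed
  show thesis
    by (rule that[OF m' hankel_det_Suc[OF riccati_nth(1)[OF r] rec]])
qed

lemma hankel_det_1: "hankel_det s 1 = s 0"
  by (simp add: hankel_det_def det_single)

text \<open>Each step of the J-fraction lowers the order of the determinant by one, so nonvanishing,
  independence of the shift and the ratio formula follow by induction on the order, for all
  \<open>k\<close> and all series at once.\<close>

lemma hankel_det_orbit:
  fixes f u v u1 :: complex and vs d :: "nat \<Rightarrow> complex"
  defines "s \<equiv> hankel_s f u1 (vs 0) (vs 1) (d 1)"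
    and "s' \<equiv> hankel_s_tilde u1 (vs 0) (vs 1) (d 0) (d 1)"
  assumes rel: "\<And>n. d n + d (Suc n) + (vs n)^2 + f = 0"
      "\<And>n. d (Suc n) * (vs n + vs (Suc n)) = u"
      "\<And>n. d (Suc n) * (vs n * vs (Suc n)) = d (Suc n) * (f + d (Suc n)) + u * v"
    and u1: "u1 \<noteq> 0" and d_nz: "\<And>n. d n \<noteq> 0"
  shows "\<And>n. n \<ge> 2 \<Longrightarrow> d n = hankel_det s' n * hankel_det s' (n - 2) / (hankel_det s' (n - 1))^2"
    and "\<And>n. hankel_det s' n = hankel_det s n"
    and "\<And>n. hankel_det s' (n + 4) * hankel_det s' n = u^2 * hankel_det s' (n + 3) * hankel_det s' (n + 1)
          + u^2 * (v^2 + f) * (hankel_det s' (n + 2))^2"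
proof -
  define c where "c = u1 / 2"
  have c: "c \<noteq> 0" using u1 by (simp add: c_def)
  \<comment> \<open>\<open>R w k m\<close> says that \<open>m\<close> is a moment series of stage
    \<open>k\<close> in the shift \<open>w\<close>. It involves \<open>d (Suc k)\<close>, so the
    factor split off by a step is \<open>d (Suc (Suc k))\<close>.\<close>
  define R where "R w k m \<longleftrightarrow> riccati w f (vs k) (vs (Suc k)) (d (Suc k)) m" for w k m
  have step: thesis
    if "R w k m"
      and "\<And>m'. R w (Suc k) m' \<Longrightarrow>
        (\<And>n. hankel_det (fps_nth m) (Suc n) = d (Suc (Suc k)) ^ n * hankel_det (fps_nth m') n)
        \<Longrightarrow> thesis" for w k m thesis
  proof -
    have "d (Suc k) * (vs k + vs (Suc k)) = d (Suc (Suc k)) * (vs (Suc k) + vs (Suc (Suc k)))"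
      by (simp only: rel(2))
    then show ?thesis
      using hankel_det_riccati_step[OF that(1)[unfolded R_def] rel(1) _ d_nz] that(2)
      unfolding R_def by blast
  qed
  have nz: "hankel_det (fps_nth m) n \<noteq> 0" if "R w k m" for w k m n
    using that
  proof (induction n arbitrary: k m)
    case (Suc n)
    show ?case by (rule step[OF Suc.prems]) (use Suc.IH d_nz in simp)
  qed simp
  \<comment> \<open>The shifts \<open>w\<close> and \<open>w'\<close> may differ, since both sides
    lose the same power of \<open>d (Suc (Suc k))\<close>.\<close>
  have same: "hankel_det (fps_nth m) n = hankel_det (fps_nth m') n"
    if "R w k m" "R w' k m'" for w w' k m m' n
    using that
  proof (induction n arbitrary: k m m')
    case (Suc n)
    show ?case
      by (rule step[OF Suc.prems(1)], rule step[OF Suc.prems(2)]) (metis Suc.IH)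
  qed simp
  have ratio: "hankel_det (fps_nth m) (n + 2) * hankel_det (fps_nth m) n
      = d (k + n + 2) * (hankel_det (fps_nth m) (n + 1))^2" if "R w k m" for w k m n
    using that
  proof (induction n arbitrary: k m)
    case 0
    show ?case
    proof (rule step[OF 0])
      fix m' assume m': "R w (Suc k) m'"
        "\<And>n. hankel_det (fps_nth m) (Suc n) = d (Suc (Suc k)) ^ n * hankel_det (fps_nth m') n"
      show ?thesis
        using m'(2)[of 0] m'(2)[of 1] riccati_nth(1)[OF m'(1)[unfolded R_def]] hankel_det_1[of "fps_nth m'"]
        by (simp add: numeral_2_eq_2)
    qed
  next
    case (Suc n)
    show ?case
    proof (rule step[OF Suc.prems])
      fix m' assume m': "R w (Suc k) m'"
        "\<And>n. hankel_det (fps_nth m) (Suc n) = d (Suc (Suc k)) ^ n * hankel_det (fps_nth m') n"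
      let ?h = "\<lambda>n. hankel_det (fps_nth m') n"
      let ?e = "d (Suc (Suc k))"
      have "hankel_det (fps_nth m) (Suc n + 2) * hankel_det (fps_nth m) (Suc n)
          = ?e ^ (n + 2) * ?e ^ n * (?h (n + 2) * ?h n)"
        using m'(2)[of n] m'(2)[of "n + 2"] by simp
      also have "\<dots> = d (Suc k + n + 2) * (?e ^ (n + 1) * ?h (n + 1))^2"
        unfolding Suc.IH[OF m'(1)] by (simp add: power2_eq_square mult_ac)
      also have "?e ^ (n + 1) * ?h (n + 1) = hankel_det (fps_nth m) (Suc n + 1)"
        using m'(2)[of "n + 1"] by simp
      finally show ?thesis by simp
    qed
  qed
  define m where "m = Abs_fps (\<lambda>j. inverse c * s j)"
  define m' where "m' = Abs_fps (\<lambda>j. inverse c * s' j)"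
  \<comment> \<open>Both sequences belong to stage 0, with shifts 0 and \<open>vs 0\<close>; this is
    what makes \<open>same\<close> applicable.\<close>
  have R: "R 0 0 m" "R (vs 0) 0 m'"
    using riccati_hankel_s[of u1] riccati_hankel_s_tilde[of u1, OF _ rel(1)[of 0]] u1
    by (simp_all add: R_def m_def m'_def s_def s'_def c_def)
  have scale: "hankel_det s n = c ^ n * hankel_det (fps_nth m) n"
    "hankel_det s' n = c ^ n * hankel_det (fps_nth m') n" for n
    using hankel_det_scale[of "inverse c" s n] hankel_det_scale[of "inverse c" s' n] c
    by (simp_all add: m_def m'_def Abs_fps_inverse power_mult_distrib[symmetric] flip: mult.assoc)
  define D where "D = hankel_det s'"
  have D_nz: "D n \<noteq> 0" for n
    using nz[OF R(2)] c by (simp add: D_def scale)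
  \<comment> \<open>The powers of \<open>c\<close> balance because
    \<open>(n + 2) + n = 2 * (n + 1)\<close>.\<close>
  have D_ratio: "D (n + 2) * D n = d (n + 2) * (D (n + 1))^2" for n
  proof -
    have "D (n + 2) * D n
        = c ^ (2 * n + 2) * (hankel_det (fps_nth m') (n + 2) * hankel_det (fps_nth m') n)"
      by (simp add: D_def scale power_add mult_2 mult_2_right mult_ac power2_eq_square)
    also have "\<dots> = d (n + 2) * (D (n + 1))^2"
      unfolding ratio[OF R(2)]
      by (simp add: D_def scale power_add mult_2 mult_2_right mult_ac power2_eq_square)
    finally show ?thesis .
  qed
  have main1: "d n = D n * D (n - 2) / (D (n - 1))^2" if "n \<ge> 2" for n
  proof -
    have "Suc (n - 2) = n - 1" "Suc (Suc (n - 2)) = n" using that by auto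
    then show ?thesis using D_ratio[of "n - 2"] D_nz[of "n - 1"] by (simp add: field_simps)
  qed
  have main2: "D n = hankel_det s n" for n
    using same[OF R] by (simp add: D_def scale)
  have main3: "D (n + 4) * D n = u^2 * D (n + 3) * D (n + 1) + u^2 * (v^2 + f) * (D (n + 2))^2" for n
  proof -
    define A B C where "A = D (n + 1)" and "B = D (n + 2)" and "C = D (n + 3)"
    have nz: "A \<noteq> 0" "B \<noteq> 0" "C \<noteq> 0" using D_nz by (auto simp: A_def B_def C_def)
    have r: "B * D n = d (n + 2) * A^2" "C * A = d (n + 3) * B^2" "D (n + 4) * B = d (n + 4) * C^2"
      using D_ratio[of n] D_ratio[of "n + 1"] D_ratio[of "n + 2"]
      by (simp_all add: A_def B_def C_def numeral_eq_Suc)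
    have so: "d (n + 2) * d (n + 3)^2 * d (n + 4) = u^2 * d (n + 3) + u^2 * (v^2 + f)"
      using somos_product[OF rel(1)[of "n + 2"] rel(1)[of "Suc (n + 2)"]] rel(2,3)[of "n + 2"]
      by (simp add: numeral_eq_Suc)
    \<comment> \<open>The outer two ratio relations are multiplied, and the middle one replaces
      \<open>C * A\<close>; the factor \<open>B^2\<close> then cancels.\<close>
    have "B^2 * (D (n + 4) * D n) = d (n + 2) * d (n + 4) * (C * A)^2"
      using r(1,3) by Groebner_Basis.algebra
    also have "\<dots> = B^2 * (B^2 * (d (n + 2) * d (n + 3)^2 * d (n + 4)))"
      unfolding r(2) by Groebner_Basis.algebra
    finally have "D (n + 4) * D n = B^2 * (d (n + 2) * d (n + 3)^2 * d (n + 4))"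
      by (rule mult_left_cancel[THEN iffD1, rotated]) (use nz in simp)
    also have "\<dots> = u^2 * (d (n + 3) * B^2) + u^2 * (v^2 + f) * B^2"
      unfolding so by Groebner_Basis.algebra
    finally have "D (n + 4) * D n = u^2 * (C * A) + u^2 * (v^2 + f) * B^2"
      unfolding r(2) .
    then show ?thesis
      unfolding A_def B_def C_def by (simp only: mult.assoc)
  qed
  show "\<And>n. n \<ge> 2 \<Longrightarrow> d n = hankel_det s' n * hankel_det s' (n - 2) / (hankel_det s' (n - 1))^2"
    and "\<And>n. hankel_det s' n = hankel_det s n"
    and "\<And>n. hankel_det s' (n + 4) * hankel_det s' n = u^2 * hankel_det s' (n + 3) * hankel_det s' (n + 1)
          + u^2 * (v^2 + f) * (hankel_det s' (n + 2))^2"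
    using main1 main2 main3 unfolding D_def by blast+
qed

theorem theorem5p3:
  fixes f u v :: complex
    and Y :: "complex fls"
    and us vs d :: "nat \<Rightarrow> complex"
  assumes Y: "is_branch_infty1 (curve_F f u v) Y"
    and Q0_dvd: "poly_Q (us 0) (vs 0) dvd curve_F f u v - (poly_P f (d 0))^2"
    and Yn: "\<And>n. complete_quotient
                   ((Y + at_infty (poly_P f (d 0))) / at_infty (poly_Q (us 0) (vs 0))) n
                 = (Y + at_infty (poly_P f (d n))) / at_infty (poly_Q (us n) (vs n))"
    and us_nz: "\<And>n. us n \<noteq> 0"
    and d_nz: "\<And>n. d n \<noteq> 0"
  shows "let D = hankel_det (hankel_s_tilde (us 1) (vs 0) (vs 1) (d 0) (d 1));
             \<Delta> = hankel_det (hankel_s f (us 1) (vs 0) (vs 1) (d 1))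
         in (\<forall>n\<ge>2. d n = D n * D (n - 2) / (D (n - 1))^2)
            \<and> (\<forall>n. D n = \<Delta> n)
            \<and> (\<forall>n. D (n + 4) * D n = u^2 * D (n + 3) * D (n + 1) + u^2 * (v^2 + f) * (D (n + 2))^2)"
proof -
  note orbit = hankel_det_orbit[of d vs f u v "us 1",
      OF continued_fraction_relations[OF Y Yn us_nz] us_nz d_nz]
  show ?thesis
    unfolding Let_def by (intro conjI allI impI orbit)
qed

end
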